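(* Let $(\mathfrak g,[\cdot,\cdot,\cdot]_{\mathfrak g})$ be a $3$-Lie algebra, $(V;\rho)$ a representation of $\mathfrak g$, $\Phi$ a $2$-cocycle on $\mathfrak g$ with coefficients in $(V;\rho)$, and let $T:V\to\mathfrak g$ be a $\Phi$-twisted Rota-Baxter operator on $\mathfrak g$ with respect to $(V;\rho)$. Define $\varrho:\wedge^2V\to\mathfrak{gl}(\mathfrak g)$ by $$\varrho(u,v)(x)=[Tu,Tv,x]_{\mathfrak g}-T\big(\rho(x,Tu)v+\rho(Tv,x)u+\Phi(Tu,Tv,x)\big),\qquad x\in\mathfrak g,\ u,v\in V.$$ Then $(\mathfrak g;\varrho)$ is a representation of the $3$-Lie algebra $(V,[\cdot,\cdot,\cdot]_T)$, where $$[u,v,w]_T=\rho(Tu,Tv)w+\rho(Tv,Tw)u+\rho(Tw,Tu)v+\Phi(Tu,Tv,Tw),\qquad u,v,w\in V.$$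
   Context: All vector spaces are over a fixed field. A 3-Lie algebra is a vector space $\mathfrak g$ with a skew-symmetric trilinear map $[\cdot,\cdot,\cdot]_{\mathfrak g}$ (i.e. a linear map $\wedge^3\mathfrak g\to\mathfrak g$) such that for all $x_1,\dots,x_5\in\mathfrak g$: $[x_1,x_2,[x_3,x_4,x_5]_{\mathfrak g}]_{\mathfrak g}=[[x_1,x_2,x_3]_{\mathfrak g},x_4,x_5]_{\mathfrak g}+[x_3,[x_1,x_2,x_4]_{\mathfrak g},x_5]_{\mathfrak g}+[x_3,x_4,[x_1,x_2,x_5]_{\mathfrak g}]_{\mathfrak g}$. A representation of $\mathfrak g$ is a pair $(V;\rho)$ with $V$ a vector space and $\rho:\wedge^2\mathfrak g\to\mathfrak{gl}(V)$ linear such that for all $x_1,\dots,x_4\in\mathfrak g$: (i) $[\rho(x_1,x_2),\rho(x_3,x_4)]=\rho([x_1,x_2,x_3]_{\mathfrak g},x_4)+\rho(x_3,[x_1,x_2,x_4]_{\mathfrak g})$ (commutator on the left); (ii) $\rho([x_1,x_2,x_3]_{\mathfrak g},x_4)=\rho(x_1,x_2)\rho(x_3,x_4)+\rho(x_2,x_3)\rho(x_1,x_4)+\rho(x_3,x_1)\rho(x_2,x_4)$. A 2-cocycle on $\mathfrak g$ with coefficients in $(V;\rho)$ is a linear map $\Phi:\wedge^3\mathfrak g\to V$ such that for all $x_1,\dots,x_5\in\mathfrak g$: $\Phi(x_1,x_2,[x_3,x_4,x_5]_{\mathfrak g})-\Phi([x_1,x_2,x_3]_{\mathfrak g},x_4,x_5)-\Phi(x_3,[x_1,x_2,x_4]_{\mathfrak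 g},x_5)-\Phi(x_3,x_4,[x_1,x_2,x_5]_{\mathfrak g})+\rho(x_1,x_2)\Phi(x_3,x_4,x_5)-\rho(x_3,x_4)\Phi(x_1,x_2,x_5)-\rho(x_4,x_5)\Phi(x_1,x_2,x_3)-\rho(x_5,x_3)\Phi(x_1,x_2,x_4)=0$. A $\Phi$-twisted Rota-Baxter operator on $\mathfrak g$ with respect to $(V;\rho)$ is a linear map $T:V\to\mathfrak g$ with $[Tu,Tv,Tw]_{\mathfrak g}=T\big(\rho(Tu,Tv)w+\rho(Tv,Tw)u+\rho(Tw,Tu)v+\Phi(Tu,Tv,Tw)\big)$ for all $u,v,w\in V$. For such $T$, the bracket $[\cdot,\cdot,\cdot]_T$ in the claim makes $V$ a 3-Lie algebra. *)

theory Defs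
  imports Complex_Main
begin

(* Linear maps out of the exterior powers \<wedge>^2 A and \<wedge>^3 A are rendered, via the universal property,
   as multilinear maps that vanish whenever two arguments coincide.  In characteristic 2 this is
   stronger than invariance up to sign under permutations. *)

locale alternating_trilinear =
  fixes scaleA :: "'k::field \<Rightarrow> 'a::ab_group_add \<Rightarrow> 'a"
    and scaleB :: "'k \<Rightarrow> 'b::ab_group_add \<Rightarrow> 'b"
    and f :: "'a \<Rightarrow> 'a \<Rightarrow> 'a \<Rightarrow> 'b"
  assumes linear_1: "Vector_Spaces.linear scaleA scaleB (\<lambda>x. f x y z)"
    and linear_2: "Vector_Spaces.linear scaleA scaleB (\<lambda>y. f x y z)"
    and linear_3: "Vector_Spaces.linear scaleA scaleB (\<lambda>z. f x y z)"
    and alternating_12: "f x x y = 0"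
    and alternating_13: "f x y x = 0"
    and alternating_23: "f y x x = 0"

(* A linear map \<wedge>^2 A \<rightarrow> gl(B); equalities in gl(B) are stated pointwise. *)
locale alternating_bilinear_gl =
  fixes scaleA :: "'k::field \<Rightarrow> 'a::ab_group_add \<Rightarrow> 'a"
    and scaleB :: "'k \<Rightarrow> 'b::ab_group_add \<Rightarrow> 'b"
    and \<rho> :: "'a \<Rightarrow> 'a \<Rightarrow> 'b \<Rightarrow> 'b"
  assumes endomorphism: "Vector_Spaces.linear scaleB scaleB (\<rho> x y)"
    and linear_1: "Vector_Spaces.linear scaleA scaleB (\<lambda>x. \<rho> x y v)"
    and linear_2: "Vector_Spaces.linear scaleA scaleB (\<lambda>y. \<rho> x y v)"
    and alternating: "\<rho> x x v = 0"

locale three_lie_algebra =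
  vector_space scale + alternating_trilinear scale scale br
  for scale :: "'k::field \<Rightarrow> 'g::ab_group_add \<Rightarrow> 'g"
    and br :: "'g \<Rightarrow> 'g \<Rightarrow> 'g \<Rightarrow> 'g" +
  assumes fundamental_identity:
    "br x1 x2 (br x3 x4 x5) =
       br (br x1 x2 x3) x4 x5 + br x3 (br x1 x2 x4) x5 + br x3 x4 (br x1 x2 x5)"

locale three_lie_representation =
  g: three_lie_algebra scaleG br + V: vector_space scaleV +
  rho: alternating_bilinear_gl scaleG scaleV \<rho>
  for scaleG :: "'k::field \<Rightarrow> 'g::ab_group_add \<Rightarrow> 'g"
    and br :: "'g \<Rightarrow> 'g \<Rightarrow> 'g \<Rightarrow> 'g"
    and scaleV :: "'k \<Rightarrow> 'v::ab_group_add \<Rightarrow> 'v"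
    and \<rho> :: "'g \<Rightarrow> 'g \<Rightarrow> 'v \<Rightarrow> 'v" +
  assumes rep_commutator:
    "\<rho> x1 x2 (\<rho> x3 x4 v) - \<rho> x3 x4 (\<rho> x1 x2 v) =
       \<rho> (br x1 x2 x3) x4 v + \<rho> x3 (br x1 x2 x4) v"
    and rep_bracket:
    "\<rho> (br x1 x2 x3) x4 v =
       \<rho> x1 x2 (\<rho> x3 x4 v) + \<rho> x2 x3 (\<rho> x1 x4 v) + \<rho> x3 x1 (\<rho> x2 x4 v)"

locale three_lie_2_cocycle =
  three_lie_representation scaleG br scaleV \<rho> +
  Phi: alternating_trilinear scaleG scaleV \<Phi>
  for scaleG :: "'k::field \<Rightarrow> 'g::ab_group_add \<Rightarrow> 'g"
    and br :: "'g \<Rightarrow> 'g \<Rightarrow> 'g \<Rightarrow> 'g"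
    and scaleV :: "'k \<Rightarrow> 'v::ab_group_add \<Rightarrow> 'v"
    and \<rho> :: "'g \<Rightarrow> 'g \<Rightarrow> 'v \<Rightarrow> 'v"
    and \<Phi> :: "'g \<Rightarrow> 'g \<Rightarrow> 'g \<Rightarrow> 'v" +
  assumes cocycle:
    "\<Phi> x1 x2 (br x3 x4 x5) - \<Phi> (br x1 x2 x3) x4 x5
       - \<Phi> x3 (br x1 x2 x4) x5 - \<Phi> x3 x4 (br x1 x2 x5)
       + \<rho> x1 x2 (\<Phi> x3 x4 x5) - \<rho> x3 x4 (\<Phi> x1 x2 x5)
       - \<rho> x4 x5 (\<Phi> x1 x2 x3) - \<rho> x5 x3 (\<Phi> x1 x2 x4) = 0"

definition twisted_bracket ::
  "('g \<Rightarrow> 'g \<Rightarrow> 'v \<Rightarrow> 'v) \<Rightarrow> ('g \<Rightarrow> 'g \<Rightarrow> 'g \<Rightarrow> 'v) \<Rightarrow> ('v \<Rightarrow> 'g)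
     \<Rightarrow> 'v \<Rightarrow> 'v \<Rightarrow> 'v \<Rightarrow> 'v::ab_group_add"
  where "twisted_bracket \<rho> \<Phi> T u v w =
    \<rho> (T u) (T v) w + \<rho> (T v) (T w) u + \<rho> (T w) (T u) v + \<Phi> (T u) (T v) (T w)"

locale twisted_rota_baxter =
  three_lie_2_cocycle scaleG br scaleV \<rho> \<Phi> +
  T: Vector_Spaces.linear scaleV scaleG T
  for scaleG :: "'k::field \<Rightarrow> 'g::ab_group_add \<Rightarrow> 'g"
    and br :: "'g \<Rightarrow> 'g \<Rightarrow> 'g \<Rightarrow> 'g"
    and scaleV :: "'k \<Rightarrow> 'v::ab_group_add \<Rightarrow> 'v"
    and \<rho> :: "'g \<Rightarrow> 'g \<Rightarrow> 'v \<Rightarrow> 'v"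
    and \<Phi> :: "'g \<Rightarrow> 'g \<Rightarrow> 'g \<Rightarrow> 'v"
    and T :: "'v \<Rightarrow> 'g" +
  assumes twisted_rota_baxter:
    "br (T u) (T v) (T w) =
       T (\<rho> (T u) (T v) w + \<rho> (T v) (T w) u + \<rho> (T w) (T u) v + \<Phi> (T u) (T v) (T w))"

definition twisted_action ::
  "('g \<Rightarrow> 'g \<Rightarrow> 'g \<Rightarrow> 'g::ab_group_add) \<Rightarrow> ('g \<Rightarrow> 'g \<Rightarrow> 'v \<Rightarrow> 'v::ab_group_add)
     \<Rightarrow> ('g \<Rightarrow> 'g \<Rightarrow> 'g \<Rightarrow> 'v) \<Rightarrow> ('v \<Rightarrow> 'g) \<Rightarrow> 'v \<Rightarrow> 'v \<Rightarrow> 'g \<Rightarrow> 'g"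
  where "twisted_action br \<rho> \<Phi> T u v x =
    br (T u) (T v) x - T (\<rho> x (T u) v + \<rho> (T v) x u + \<Phi> (T u) (T v) x)"

end

theory Submission
  imports Defs "HOL-Analysis.Product_Vector"
begin

text \<open>
  The \<open>\<Phi>\<close>-twisted semidirect product of \<open>\<gg>\<close> and \<open>V\<close> is a 3-Lie algebra, and the graph
  \<open>{(Tu, u)}\<close> is a subalgebra of it because \<open>T\<close> is a \<open>\<Phi>\<close>-twisted Rota-Baxter operator; the
  bracket induced on \<open>V\<close> is \<open>[\<cdot>,\<cdot>,\<cdot>]\<^sub>T\<close>. A subalgebra \<open>H\<close> of a 3-Lie algebra \<open>E\<close> acts on \<open>E / H\<close>
  through the bracket of \<open>E\<close>. Identifying the quotient by the graph with \<open>\<gg>\<close> via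
  \<open>(x, u) \<mapsto> x - Tu\<close> turns this action into the twisted action of \<open>V\<close> on \<open>\<gg>\<close>.
\<close>

lemma (in alternating_trilinear) trilinear_add:
  "f (x + x') y z = f x y z + f x' y z"
  "f x (y + y') z = f x y z + f x y' z"
  "f x y (z + z') = f x y z + f x y z'"
  using linear_1 linear_2 linear_3
  by (auto simp: Vector_Spaces.linear_iff)

lemma (in alternating_trilinear) trilinear_scale:
  "f (scaleA c x) y z = scaleB c (f x y z)"
  "f x (scaleA c y) z = scaleB c (f x y z)"
  "f x y (scaleA c z) = scaleB c (f x y z)"
  using linear_1 linear_2 linear_3
  by (auto simp: Vector_Spaces.linear_iff)

lemma (in alternating_trilinear) swap_12: "f y x z = - f x y z"
  using alternating_12[of "x + y" z]
  unfolding trilinear_add by (simp add: alternating_12 eq_neg_iff_add_eq_0 add.commute)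

lemma (in alternating_trilinear) swap_23: "f x z y = - f x y z"
  using alternating_23[of x "y + z"]
  unfolding trilinear_add by (simp add: alternating_23 eq_neg_iff_add_eq_0 add.commute)

lemma (in alternating_trilinear) rotate: "f y z x = f x y z"
  by (simp add: swap_23[of y x z] swap_12[of x y z])

lemma (in alternating_bilinear_gl) bilinear_add:
  "\<rho> (x + x') y v = \<rho> x y v + \<rho> x' y v"
  "\<rho> x (y + y') v = \<rho> x y v + \<rho> x y' v"
  "\<rho> x y (v + v') = \<rho> x y v + \<rho> x y v'"
  using linear_1 linear_2 endomorphism
  by (auto simp: Vector_Spaces.linear_iff)

lemma (in alternating_bilinear_gl) bilinear_scale:
  "\<rho> (scaleA c x) y v = scaleB c (\<rho> x y v)"
  "\<rho> x (scaleA c y) v = scaleB c (\<rho> x y v)"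
  "\<rho> x y (scaleB c v) = scaleB c (\<rho> x y v)"
  using linear_1 linear_2 endomorphism
  by (auto simp: Vector_Spaces.linear_iff)

lemma (in alternating_bilinear_gl) minus_right: "\<rho> x y (- v) = - \<rho> x y v"
  by (rule module_hom.neg[OF module_hom_linearI]) (rule endomorphism)

lemma (in alternating_bilinear_gl) swap: "\<rho> y x v = - \<rho> x y v"
  using alternating[of "x + y" v]
  unfolding bilinear_add by (simp add: alternating eq_neg_iff_add_eq_0 add.commute)

text \<open>Rotating the inner bracket into the last slot makes the fundamental identity applicable;
  further cyclic rotations, which cost no sign, restore the order. This is condition
  \<open>rep_bracket\<close> for the adjoint action.\<close>

lemma (in three_lie_algebra) bracket_left:
  "br (br x1 x2 x3) x4 x5 =
     br x1 x2 (br x3 x4 x5) + br x2 x3 (br x1 x4 x5) + br x3 x1 (br x2 x4 x5)"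
proof -
  have "br (br x1 x2 x3) x4 x5 = br x4 x5 (br x1 x2 x3)"
    by (rule rotate[symmetric])
  also have "\<dots> = br (br x4 x5 x1) x2 x3 + br x1 (br x4 x5 x2) x3 + br x1 x2 (br x4 x5 x3)"
    by (rule fundamental_identity)
  also have "br (br x4 x5 x1) x2 x3 = br x2 x3 (br x1 x4 x5)"
    by (simp only: rotate[of x4 x5 x1] rotate[of x2 x3])
  also have "br x1 (br x4 x5 x2) x3 = br x3 x1 (br x2 x4 x5)"
    by (simp only: rotate[of x4 x5 x2] rotate[of x1 _ x3])
  also have "br x1 x2 (br x4 x5 x3) = br x1 x2 (br x3 x4 x5)"
    by (simp only: rotate[of x4 x5 x3])
  finally show ?thesis
    by (simp add: ac_simps)
qed

text \<open>Since \<open>i\<close> is injective, every axiom may be tested after applying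
  \<open>i\<close>, where it becomes the same axiom for \<open>br\<close>.\<close>

lemma (in three_lie_algebra) subalgebra:
  assumes "Vector_Spaces.linear scaleH scale i" "inj i"
    and hom: "\<And>u v w. i (brH u v w) = br (i u) (i v) (i w)"
  shows "three_lie_algebra scaleH brH"
proof -
  interpret i: Vector_Spaces.linear scaleH scale i by fact
  have ext: "u = v" if "i u = i v" for u v
    using that assms(2) by (simp add: inj_eq)
  note i_simps = hom i.add i.scale i.zero trilinear_add trilinear_scale
    alternating_12 alternating_13 alternating_23
  have H: "vector_space scaleH" by unfold_locales
  show ?thesis
  proof (intro three_lie_algebra.intro alternating_trilinear.intro three_lie_algebra_axioms.intro)
    show "vector_space scaleH" by fact
    show "brH x1 x2 (brH x3 x4 x5) =
        brH (brH x1 x2 x3) x4 x5 + brH x3 (brH x1 x2 x4) x5 + brH x3 x4 (brH x1 x2 x5)"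
      for x1 x2 x3 x4 x5
      by (rule ext, unfold hom i.add, rule fundamental_identity)
  qed (auto simp: Vector_Spaces.linear_iff H i_simps intro!: ext)
qed

text \<open>The quotient by the subalgebra is presented by a surjection \<open>p\<close>; \<open>act\<close> forces the action to be
  well defined on it.\<close>
lemma (in three_lie_algebra) quotient_representation:
  assumes i: "Vector_Spaces.linear scaleH scale i" "inj i"
    and p: "Vector_Spaces.linear scale scaleQ p" "surj p"
    and hom: "\<And>u v w. i (brH u v w) = br (i u) (i v) (i w)"
    and act: "\<And>u v e. \<sigma> u v (p e) = p (br (i u) (i v) e)"
  shows "three_lie_representation scaleH brH scaleQ \<sigma>"
proof -
  interpret i: Vector_Spaces.linear scaleH scale i by fact
  interpret p: Vector_Spaces.linear scale scaleQ p by fact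
  have H: "vector_space scaleH" by unfold_locales
  have Q: "vector_space scaleQ" by unfold_locales
  \<comment> \<open>Each claim about \<open>\<sigma>\<close> at \<open>x\<close> is checked on a
    preimage \<open>e\<close>, where \<open>act\<close> turns it into a claim about
    \<open>br\<close>.\<close>
  have lift: "\<exists>e. x = p e" for x
    using p(2) by (rule surjD)
  have \<sigma>_linear: "Vector_Spaces.linear scaleQ scaleQ (\<sigma> u v)" for u v
  proof -
    \<comment> \<open>\<open>p.add\<close> and \<open>p.scale\<close> are used backwards, because
      \<open>act\<close> only rewrites at arguments of the form \<open>p e\<close>.\<close>
    have "\<sigma> u v (x + y) = \<sigma> u v x + \<sigma> u v y" for x y
      using lift[of x] lift[of y] by (auto simp: act trilinear_add simp flip: p.add)
    moreover have "\<sigma> u v (scaleQ c x) = scaleQ c (\<sigma> u v x)" for c x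
      using lift[of x] by (auto simp: act trilinear_scale simp flip: p.scale)
    ultimately show ?thesis by (simp add: Vector_Spaces.linear_iff Q)
  qed
  show ?thesis
  proof (intro three_lie_representation.intro alternating_bilinear_gl.intro
      three_lie_representation_axioms.intro)
    show "three_lie_algebra scaleH brH"
      by (rule subalgebra[OF i hom])
    show "vector_space scaleQ" by (fact Q)
    show "Vector_Spaces.linear scaleQ scaleQ (\<sigma> u v)" for u v
      by (fact \<sigma>_linear)
    show "Vector_Spaces.linear scaleH scaleQ (\<lambda>u. \<sigma> u v x)" for v x
      using lift[of x]
      by (auto simp: Vector_Spaces.linear_iff H Q act i.add i.scale trilinear_add trilinear_scale p.add p.scale)
    show "Vector_Spaces.linear scaleH scaleQ (\<lambda>v. \<sigma> u v x)" for u x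
      using lift[of x]
      by (auto simp: Vector_Spaces.linear_iff H Q act i.add i.scale trilinear_add trilinear_scale p.add p.scale)
    show "\<sigma> u u x = 0" for u x
      using lift[of x] by (auto simp: act alternating_12 p.zero)
    \<comment> \<open>With \<open>e\<close> as last entry, the fundamental identity is the
      commutator rule for the adjoint action; \<open>p\<close> carries it over. In the same way
      \<open>bracket_left\<close> gives the second condition.\<close>
    show "\<sigma> u1 u2 (\<sigma> u3 u4 x) - \<sigma> u3 u4 (\<sigma> u1 u2 x) =
        \<sigma> (brH u1 u2 u3) u4 x + \<sigma> u3 (brH u1 u2 u4) x" for u1 u2 u3 u4 x
      using lift[of x] fundamental_identity[of "i u1" "i u2" "i u3" "i u4"]
      by (auto simp: act hom p.add)
    show "\<sigma> (brH u1 u2 u3) u4 x =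
        \<sigma> u1 u2 (\<sigma> u3 u4 x) + \<sigma> u2 u3 (\<sigma> u1 u4 x) + \<sigma> u3 u1 (\<sigma> u2 u4 x)" for u1 u2 u3 u4 x
      using lift[of x] bracket_left[of "i u1" "i u2" "i u3" "i u4"]
      by (auto simp: act hom p.add)
  qed
qed

text \<open>The extension with abelian kernel \<open>V\<close> determined by the cocycle
  \<open>\<Phi>\<close>; for \<open>\<Phi> = 0\<close> it is the usual semidirect product.\<close>

definition twisted_semidirect ::
  "('g \<Rightarrow> 'g \<Rightarrow> 'g \<Rightarrow> 'g) \<Rightarrow> ('g \<Rightarrow> 'g \<Rightarrow> 'v \<Rightarrow> 'v::ab_group_add)
     \<Rightarrow> ('g \<Rightarrow> 'g \<Rightarrow> 'g \<Rightarrow> 'v) \<Rightarrow> 'g \<times> 'v \<Rightarrow> 'g \<times> 'v \<Rightarrow> 'g \<times> 'v \<Rightarrow> 'g \<times> 'v"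
  where "twisted_semidirect br \<rho> \<Phi> = (\<lambda>(x, u) (y, v) (z, w).
    (br x y z, \<rho> x y w + \<rho> y z u + \<rho> z x v + \<Phi> x y z))"

context three_lie_2_cocycle
begin

sublocale GV: vector_space_prod scaleG scaleV ..

text \<open>The first component repeats the axioms of \<open>br\<close>. In the second, the
  fundamental identity splits according to which vector \<open>u1\<close>, ..., \<open>u5\<close>
  occurs: each vector calls for one representation axiom, and the terms with none form the cocycle
  condition.\<close>

lemma twisted_semidirect_three_lie_algebra:
  "three_lie_algebra GV.scale (twisted_semidirect br \<rho> \<Phi>)"
proof (intro three_lie_algebra.intro alternating_trilinear.intro three_lie_algebra_axioms.intro)
  show GV: "vector_space GV.scale" by unfold_locales
  note defs = Vector_Spaces.linear_iff GV twisted_semidirect_def split_beta prod_eq_iff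
    GV.scale_def V.scale_right_distrib
    g.trilinear_add g.trilinear_scale Phi.trilinear_add Phi.trilinear_scale
    rho.bilinear_add rho.bilinear_scale
  show "Vector_Spaces.linear GV.scale GV.scale (\<lambda>a. twisted_semidirect br \<rho> \<Phi> a b c)" for b c
    by (simp add: defs)
  show "Vector_Spaces.linear GV.scale GV.scale (\<lambda>b. twisted_semidirect br \<rho> \<Phi> a b c)" for a c
    by (simp add: defs)
  show "Vector_Spaces.linear GV.scale GV.scale (\<lambda>c. twisted_semidirect br \<rho> \<Phi> a b c)" for a b
    by (simp add: defs)
  \<comment> \<open>When two entries coincide, one \<open>\<rho>\<close> term vanishes and the other
    two cancel by this equation.\<close>
  have alt: "\<rho> x y v + \<rho> y x v = 0" for x y v
    by (simp add: rho.swap[of x y])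
  show "twisted_semidirect br \<rho> \<Phi> a a b = 0" for a b
    using alt by (simp add: twisted_semidirect_def split_beta prod_eq_iff rho.alternating
        g.alternating_12 Phi.alternating_12)
  show "twisted_semidirect br \<rho> \<Phi> a b a = 0" for a b
    using alt by (simp add: twisted_semidirect_def split_beta prod_eq_iff rho.alternating
        g.alternating_13 Phi.alternating_13)
  show "twisted_semidirect br \<rho> \<Phi> b a a = 0" for a b
    using alt by (simp add: twisted_semidirect_def split_beta prod_eq_iff rho.alternating
        g.alternating_23 Phi.alternating_23)
  let ?b = "twisted_semidirect br \<rho> \<Phi>"
  show "?b h1 h2 (?b h3 h4 h5) = ?b (?b h1 h2 h3) h4 h5 + ?b h3 (?b h1 h2 h4) h5
      + ?b h3 h4 (?b h1 h2 h5)" for h1 h2 h3 h4 h5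
  proof -
    obtain x1 u1 x2 u2 x3 u3 x4 u4 x5 u5
      where h: "h1 = (x1, u1)" "h2 = (x2, u2)" "h3 = (x3, u3)" "h4 = (x4, u4)" "h5 = (x5, u5)"
      by (metis surj_pair)
    \<comment> \<open>The number in each name is that of the vector concerned. \<open>u3\<close>,
      \<open>u4\<close>, \<open>u5\<close> lie in the inner bracket, so \<open>\<rho> x1 x2\<close>
      is moved past another \<open>\<rho>\<close> by the commutator rule.\<close>
    have c5: "\<rho> x1 x2 (\<rho> x3 x4 u5) =
        \<rho> x3 x4 (\<rho> x1 x2 u5) + \<rho> (br x1 x2 x3) x4 u5 + \<rho> x3 (br x1 x2 x4) u5"
      using rep_commutator[of x1 x2 x3 x4 u5] by (simp add: algebra_simps)
    have c3: "\<rho> x1 x2 (\<rho> x4 x5 u3) =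
        \<rho> x4 x5 (\<rho> x1 x2 u3) + \<rho> (br x1 x2 x4) x5 u3 + \<rho> x4 (br x1 x2 x5) u3"
      using rep_commutator[of x1 x2 x4 x5 u3] by (simp add: algebra_simps)
    have c4: "\<rho> x1 x2 (\<rho> x5 x3 u4) =
        \<rho> x5 x3 (\<rho> x1 x2 u4) + \<rho> (br x1 x2 x5) x3 u4 + \<rho> x5 (br x1 x2 x3) u4"
      using rep_commutator[of x1 x2 x5 x3 u4] by (simp add: algebra_simps)
    \<comment> \<open>\<open>u1\<close> and \<open>u2\<close> lie outside the inner bracket, which
      therefore becomes an argument of \<open>\<rho>\<close>. For \<open>u1\<close> it is in the
      second slot, and skew-symmetry moves it to the first.\<close>
    have c1: "\<rho> x2 (br x3 x4 x5) u1 =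
        \<rho> x3 x4 (\<rho> x2 x5 u1) + \<rho> x4 x5 (\<rho> x2 x3 u1) + \<rho> x5 x3 (\<rho> x2 x4 u1)"
      by (simp add: rho.swap[of x2] rho.minus_right rep_bracket[of x3 x4 x5 x2])
    have c2: "\<rho> (br x3 x4 x5) x1 u2 =
        \<rho> x3 x4 (\<rho> x5 x1 u2) + \<rho> x4 x5 (\<rho> x3 x1 u2) + \<rho> x5 x3 (\<rho> x4 x1 u2)"
      by (rule rep_bracket)
    have c\<Phi>: "\<Phi> x1 x2 (br x3 x4 x5) + \<rho> x1 x2 (\<Phi> x3 x4 x5) =
        \<Phi> (br x1 x2 x3) x4 x5 + \<Phi> x3 (br x1 x2 x4) x5 + \<Phi> x3 x4 (br x1 x2 x5)
        + \<rho> x3 x4 (\<Phi> x1 x2 x5) + \<rho> x4 x5 (\<Phi> x1 x2 x3) + \<rho> x5 x3 (\<Phi> x1 x2 x4)"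
      using cocycle[of x1 x2 x3 x4 x5] by (simp add: algebra_simps)
    show ?thesis
      using c\<Phi> unfolding h
      by (simp add: twisted_semidirect_def g.fundamental_identity[of x1 x2 x3 x4 x5]
          rho.bilinear_add c1 c2 c3 c4 c5 algebra_simps)
  qed
qed

end

theorem lemma2p14:
  fixes scaleG :: "'k::field \<Rightarrow> 'g::ab_group_add \<Rightarrow> 'g"
    and br :: "'g \<Rightarrow> 'g \<Rightarrow> 'g \<Rightarrow> 'g"
    and scaleV :: "'k \<Rightarrow> 'v::ab_group_add \<Rightarrow> 'v"
    and \<rho> :: "'g \<Rightarrow> 'g \<Rightarrow> 'v \<Rightarrow> 'v"
    and \<Phi> :: "'g \<Rightarrow> 'g \<Rightarrow> 'g \<Rightarrow> 'v"
    and T :: "'v \<Rightarrow> 'g"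
  assumes "three_lie_algebra scaleG br"
    and "three_lie_representation scaleG br scaleV \<rho>"
    and "three_lie_2_cocycle scaleG br scaleV \<rho> \<Phi>"
    and "twisted_rota_baxter scaleG br scaleV \<rho> \<Phi> T"
  shows "three_lie_representation scaleV (twisted_bracket \<rho> \<Phi> T)
           scaleG (twisted_action br \<rho> \<Phi> T)"
proof -
  interpret twisted_rota_baxter scaleG br scaleV \<rho> \<Phi> T by fact
  interpret E: three_lie_algebra GV.scale "twisted_semidirect br \<rho> \<Phi>"
    by (rule twisted_semidirect_three_lie_algebra)
  have spaces: "vector_space scaleV" "vector_space scaleG" "vector_space GV.scale"
    by unfold_locales
  let ?i = "\<lambda>u. (T u, u)" and ?p = "\<lambda>(x, u). x - T u"
  have T_bracket: "T (twisted_bracket \<rho> \<Phi> T u v w) = br (T u) (T v) (T w)" for u v w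
    by (simp add: twisted_bracket_def twisted_rota_baxter)
  show ?thesis
  proof (rule E.quotient_representation)
    show "Vector_Spaces.linear scaleV GV.scale ?i"
      by (simp add: Vector_Spaces.linear_iff spaces T.add T.scale GV.scale_prod)
    show "inj ?i"
      by (simp add: inj_def)
    show "Vector_Spaces.linear GV.scale scaleG ?p"
      by (simp add: Vector_Spaces.linear_iff spaces T.add T.scale GV.scale_def split_beta
          g.scale_right_diff_distrib)
    show "surj ?p"
      by (rule surjI[of _ "\<lambda>x. (x, 0)"]) (simp add: T.zero)
    \<comment> \<open>The first components agree by the Rota-Baxter identity, the second by
      definition. \<open>T_bracket\<close> has to act before \<open>twisted_bracket\<close> is
      unfolded.\<close>
    show "?i (twisted_bracket \<rho> \<Phi> T u v w) = twisted_semidirect br \<rho> \<Phi> (?i u) (?i v) (?i w)"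
      for u v w
      by (simp add: T_bracket, simp add: twisted_semidirect_def twisted_bracket_def)
    show "twisted_action br \<rho> \<Phi> T u v (?p e) =
        ?p (twisted_semidirect br \<rho> \<Phi> (?i u) (?i v) e)" for u v e
    proof -
      obtain x w where e: "e = (x, w)" by fastforce
      \<comment> \<open>The Rota-Baxter identity, grouped so that the last summand is exactly what
        \<open>twisted_action\<close> subtracts at \<open>T w\<close>.\<close>
      have tb: "br (T u) (T v) (T w) = T (\<rho> (T u) (T v) w)
          + T (\<rho> (T w) (T u) v + \<rho> (T v) (T w) u + \<Phi> (T u) (T v) (T w))"
        unfolding twisted_rota_baxter T.add[symmetric] by (simp add: ac_simps)
      have "twisted_action br \<rho> \<Phi> T u v x =
          twisted_action br \<rho> \<Phi> T u v (x - T w) + twisted_action br \<rho> \<Phi> T u v (T w)"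
        using g.trilinear_add(3)[of "T u" "T v" "x - T w" "T w"]
          Phi.trilinear_add(3)[of "T u" "T v" "x - T w" "T w"]
          rho.bilinear_add(1)[of "x - T w" "T w" "T u" v]
          rho.bilinear_add(2)[of "T v" "x - T w" "T w" u]
        by (simp add: twisted_action_def T.add algebra_simps)
      moreover have "twisted_action br \<rho> \<Phi> T u v (T w) = T (\<rho> (T u) (T v) w)"
        by (simp add: twisted_action_def tb)
      ultimately show ?thesis
        by (simp add: e twisted_semidirect_def twisted_action_def T.add algebra_simps)
    qed
  qed
qed

end
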